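(* Let $1\le k\le n$, let $H:\mathbb{R}^{2n}\to\mathbb{R}$ be smooth, let $A\in\mathbb{R}^{2n\times 2k}$ satisfy $A^TJ_{2n}A=J_{2k}$, and let $x_0\in\mathbb{R}^{2n}$. Let $x(t)$ be the solution of $\dot x=J_{2n}\nabla_xH(x)$, $x(0)=x_0$, let $z(t)$ be the solution of $\dot z=J_{2k}\nabla_z\tilde H(z)$, $z(0)=A^+x_0$, where $\tilde H(z)=H(Az)$, and put $\Delta H(t):=H(x(t))-\tilde H(z(t))$. Then for all $t$ (for which both solutions are defined), $$\Delta H(t)=H(x_0)-H(AA^+x_0).$$ In particular, if $x_0\in\mathrm{Range}(A)$, then $\Delta H(t)=0$ for all such $t$.
   Context: For a positive integer $m$, $J_{2m}=\begin{bmatrix}0_m & I_m\\ -I_m & 0_m\end{bmatrix}$. For $A\in\mathbb{R}^{2n\times 2k}$, the symplectic inverse is $A^+:=J_{2k}^TA^TJ_{2n}\in\mathbb{R}^{2k\times 2n}$. *)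

theory Defs
  imports "HOL-Analysis.Analysis"
begin

text \<open>
  Vectors of even length \<open>2m\<close> are indexed by the sum type \<open>'m + 'm\<close> with \<open>m = CARD('m) \<ge> 1\<close>:
  the indices \<open>Inl i\<close> and \<open>Inr i\<close> address the first and the second block of length \<open>m\<close>.
\<close>

definition sympJ :: "real ^ ('m + 'm) ^ ('m::finite + 'm)" where
  "sympJ = (\<chi> i j. case (i, j) of
       (Inl a, Inr b) \<Rightarrow> if a = b then 1 else 0
     | (Inr a, Inl b) \<Rightarrow> if a = b then - 1 else 0
     | _ \<Rightarrow> 0)"

definition sympl_inverse ::
  "real ^ ('k::finite + 'k) ^ ('n::finite + 'n) \<Rightarrow> real ^ ('n + 'n) ^ ('k + 'k)" where
  "sympl_inverse A = transpose sympJ ** transpose A ** sympJ"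

primrec times_cont_diff :: "nat \<Rightarrow> ('a::euclidean_space \<Rightarrow> real) \<Rightarrow> bool" where
  "times_cont_diff 0 f \<longleftrightarrow> continuous_on UNIV f"
| "times_cont_diff (Suc m) f \<longleftrightarrow>
     (\<forall>x. f differentiable (at x)) \<and>
     (\<forall>v. times_cont_diff m (\<lambda>x. frechet_derivative f (at x) v))"

definition smooth :: "('a::euclidean_space \<Rightarrow> real) \<Rightarrow> bool" where
  "smooth f \<longleftrightarrow> (\<forall>m. times_cont_diff m f)"

definition grad :: "('a::euclidean_space \<Rightarrow> real) \<Rightarrow> 'a \<Rightarrow> 'a" where
  "grad f x = (THE D. GDERIV f x :> D)"

text \<open>
  The domain \<open>T\<close> is any interval containing \<open>0\<close>, so the maximal solution and each of its
  restrictions are covered; at an endpoint belonging to \<open>T\<close> the derivative is one-sided.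
\<close>

definition hamiltonian_solution ::
  "(real ^ ('m::finite + 'm) \<Rightarrow> real) \<Rightarrow> real ^ ('m + 'm) \<Rightarrow> real set \<Rightarrow>
   (real \<Rightarrow> real ^ ('m + 'm)) \<Rightarrow> bool" where
  "hamiltonian_solution H x0 T x \<longleftrightarrow>
     is_interval T \<and> 0 \<in> T \<and> x 0 = x0 \<and>
     (\<forall>t\<in>T. (x has_vector_derivative sympJ *v grad H (x t)) (at t within T))"

definition reduced_hamiltonian ::
  "real ^ ('k::finite + 'k) ^ ('n::finite + 'n) \<Rightarrow> (real ^ ('n + 'n) \<Rightarrow> real) \<Rightarrow>
   real ^ ('k + 'k) \<Rightarrow> real" where
  "reduced_hamiltonian A H z = H (A *v z)"

definition energy_error ::
  "real ^ ('k::finite + 'k) ^ ('n::finite + 'n) \<Rightarrow> (real ^ ('n + 'n) \<Rightarrow> real) \<Rightarrow>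
   (real \<Rightarrow> real ^ ('n + 'n)) \<Rightarrow> (real \<Rightarrow> real ^ ('k + 'k)) \<Rightarrow> real \<Rightarrow> real" where
  "energy_error A H x z t = H (x t) - reduced_hamiltonian A H (z t)"

end

(*
  Each Hamiltonian flow conserves its own Hamiltonian because J is skew, so the energy error is
  constant in time. Moreover A^+ A = J^T (A^T J A) = J^T J = I, so A A^+ fixes the range of A and the
  constant vanishes for initial values there.
*)
theory Submission
  imports Defs
begin

lemma transpose_sympJ: "transpose sympJ = - (sympJ :: real ^ ('m::finite + 'm) ^ ('m + 'm))"
  by (auto simp: vec_eq_iff transpose_def sympJ_def split: sum.splits)

text \<open>\<open>sympJ\<close> is orthogonal: up to sign it permutes the standard basis, and the
  two signs cancel in the product.\<close>

lemma transpose_sympJ_mult_sympJ: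
  "transpose sympJ ** sympJ = (mat 1 :: real ^ ('m::finite + 'm) ^ ('m + 'm))"
proof -
  \<comment> \<open>Each entry of the product is a sum over both blocks. Writing products of
    indicators as nested conditionals lets these sums collapse as Kronecker deltas.\<close>
  have split_UNIV: "sum f UNIV = (\<Sum>a\<in>UNIV. f (Inl a)) + (\<Sum>a\<in>UNIV. f (Inr a))"
    for f :: "'m + 'm \<Rightarrow> real"
    by (simp add: UNIV_Plus_UNIV[symmetric] sum.Plus del: UNIV_Plus_UNIV)
  have if_mult: "(if P then 1 else 0) * (if Q then 1 else (0::real)) = (if P then if Q then 1 else 0 else 0)"
    "(if P then - 1 else 0) * (if Q then - 1 else (0::real)) = (if P then if Q then 1 else 0 else 0)"
    for P Q by auto
  have "(transpose sympJ ** sympJ) $ i $ j = (mat 1 :: real ^ ('m + 'm) ^ ('m + 'm)) $ i $ j"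
    for i j :: "'m + 'm"
    by (cases i; cases j) (simp_all add: transpose_def sympJ_def matrix_matrix_mult_def mat_def
        split_UNIV if_mult)
  then show ?thesis by (simp add: vec_eq_iff)
qed

text \<open>Moving \<open>sympJ\<close> to the other factor transposes it and so flips the sign; the
  value equals its own negative. For a gradient \<open>v\<close>, this makes the Hamiltonian field
  tangent to the level sets.\<close>

lemma inner_sympJ_mult_self: "v \<bullet> (sympJ *v v) = 0"
proof -
  have "v \<bullet> (sympJ *v v) = (transpose sympJ *v v) \<bullet> v"
    by (simp add: dot_lmul_matrix)
  also have "\<dots> = - (v \<bullet> (sympJ *v v))"
    by (simp add: transpose_sympJ matrix_vector_mult_def inner_vec_def sum_negf mult.commute)
  finally show ?thesis by simp
qed

lemma sympl_inverse_mult: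
  assumes "transpose A ** sympJ ** A = sympJ"
  shows "sympl_inverse A ** A = mat 1"
  using assms
  by (simp add: sympl_inverse_def matrix_mul_assoc[symmetric] transpose_sympJ_mult_sympJ)

text \<open>\<open>grad\<close> is a definite description, so it carries information only once
  existence and uniqueness of the gradient are known.\<close>

lemma GDERIV_grad:
  fixes f :: "'a::euclidean_space \<Rightarrow> real"
  assumes "f differentiable (at x)"
  shows "GDERIV f x :> grad f x"
proof -
  obtain f' where f': "(f has_derivative f') (at x)"
    using assms by (auto simp: differentiable_def)
  \<comment> \<open>Riesz representation of the functional \<open>f'\<close>: its representing
    vector is the adjoint applied to the scalar 1.\<close>
  then have "f' = (\<lambda>h. h \<bullet> adjoint f' 1)"
    by (auto simp: adjoint_works has_derivative_linear)
  with f' have D: "GDERIV f x :> adjoint f' 1"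
    by (metis gderiv_def)
  \<comment> \<open>The derivative at a point is unique, and a vector is determined by its inner
    products with all vectors.\<close>
  moreover have "E = adjoint f' 1" if "GDERIV f x :> E" for E
    using has_derivative_unique[OF that[unfolded gderiv_def] D[unfolded gderiv_def]]
    by (metis vector_eq_ldot)
  ultimately show ?thesis
    unfolding grad_def by (rule theI)
qed

text \<open>By the chain rule the energy has derivative zero along the solution, and a convex domain
  makes it constant. Derivatives are taken within \<open>T\<close>, which covers endpoints. Both the
  full and the reduced system are instances.\<close>

lemma hamiltonian_solution_energy_conserved:
  fixes H :: "real ^ ('m::finite + 'm) \<Rightarrow> real"
  assumes diff: "\<And>y. H differentiable (at y)"
    and sol: "hamiltonian_solution H x0 T x"
    and "t \<in> T"
  shows "H (x t) = H x0"
proof -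
  have "((\<lambda>s. H (x s)) has_derivative (\<lambda>h. 0)) (at s within T)" if "s \<in> T" for s
  proof -
    let ?g = "grad H (x s)"
    have "(x has_derivative (\<lambda>h. h *\<^sub>R (sympJ *v ?g))) (at s within T)"
      using sol that by (simp add: hamiltonian_solution_def has_vector_derivative_def)
    moreover have "(H has_derivative (\<lambda>h. h \<bullet> ?g)) (at (x s))"
      using GDERIV_grad[OF diff] by (simp add: gderiv_def)
    ultimately have "((\<lambda>s. H (x s)) has_derivative (\<lambda>h. (h *\<^sub>R (sympJ *v ?g)) \<bullet> ?g)) (at s within T)"
      by (rule has_derivative_compose)
    then show ?thesis
      by (simp add: inner_commute inner_sympJ_mult_self)
  qed
  moreover have "convex T" "0 \<in> T" "x 0 = x0"
    using sol by (auto simp: hamiltonian_solution_def is_interval_convex)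
  ultimately show ?thesis
    using has_derivative_zero_unique[of T "\<lambda>s. H (x s)" 0 t] \<open>t \<in> T\<close> by simp
qed

lemma smooth_imp_differentiable: "smooth f \<Longrightarrow> f differentiable (at x)"
  unfolding smooth_def by (metis times_cont_diff.simps(2))

lemma reduced_hamiltonian_differentiable:
  assumes "\<And>y. H differentiable (at y)"
  shows "reduced_hamiltonian A H differentiable (at z)"
proof -
  have "(*v) A differentiable (at z)"
    using linear_imp_differentiable matrix_vector_mul_linear by blast
  from differentiable_chain_at[OF this assms] show ?thesis
    by (simp add: reduced_hamiltonian_def[abs_def] o_def)
qed

theorem mainTheorem3:
  fixes H :: "real ^ ('n::finite + 'n) \<Rightarrow> real"
    and A :: "real ^ ('k::finite + 'k) ^ ('n + 'n)"
    and x0 :: "real ^ ('n + 'n)"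
    and x :: "real \<Rightarrow> real ^ ('n + 'n)"
    and z :: "real \<Rightarrow> real ^ ('k + 'k)"
    and S T :: "real set"
  assumes "CARD('k) \<le> CARD('n)"
    and "smooth H"
    and "transpose A ** sympJ ** A = sympJ"
    and "hamiltonian_solution H x0 S x"
    and "hamiltonian_solution (reduced_hamiltonian A H) (sympl_inverse A *v x0) T z"
  shows "(\<forall>t\<in>S \<inter> T. energy_error A H x z t = H x0 - H ((A ** sympl_inverse A) *v x0)) \<and>
         (x0 \<in> range ((*v) A) \<longrightarrow> (\<forall>t\<in>S \<inter> T. energy_error A H x z t = 0))"
proof -
  have diff: "H differentiable (at y)" for y
    by (rule smooth_imp_differentiable[OF \<open>smooth H\<close>])
  \<comment> \<open>Both energies keep their values at time 0; the reduced one starts at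
    \<open>H (A *v (sympl_inverse A *v x0))\<close>.\<close>
  have err: "energy_error A H x z t = H x0 - H ((A ** sympl_inverse A) *v x0)" if "t \<in> S \<inter> T" for t
    using that
      hamiltonian_solution_energy_conserved[OF diff assms(4), of t]
      hamiltonian_solution_energy_conserved[OF reduced_hamiltonian_differentiable[OF diff] assms(5), of t]
    by (simp add: energy_error_def reduced_hamiltonian_def matrix_vector_mul_assoc)
  have "(A ** sympl_inverse A) *v x0 = x0" if "x0 \<in> range ((*v) A)"
  proof -
    \<comment> \<open>Regrouping \<open>A ** sympl_inverse A ** A\<close> brings out the left
      inverse identity.\<close>
    have "(A ** sympl_inverse A) *v (A *v w) = A *v w" for w
      using sympl_inverse_mult[OF assms(3)]
      by (simp add: matrix_vector_mul_assoc matrix_mul_assoc[symmetric])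
    with that show ?thesis by blast
  qed
  with err show ?thesis by simp
qed

end
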